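(* Let $\mathcal{M}$ be the set of ultrafilters $\mathcal{U}$ on $\mathbb{N}$ such that $\mathcal{V}\leq_{fe}\mathcal{U}$ for every ultrafilter $\mathcal{V}$ on $\mathbb{N}$. Then $\mathcal{M}=\overline{K(\beta\mathbb{N},\oplus)}$.
   Context: $\mathbb{N}=\{0,1,2,\dots\}$. For $A,B\subseteq\mathbb{N}$, $A\leq_{fe}B$ ($A$ is finitely embeddable in $B$) means that for every finite $F\subseteq A$ there is $k\in\mathbb{N}$ with $F+k=\{a+k\mid a\in F\}\subseteq B$. For ultrafilters $\mathcal{U},\mathcal{V}$ on $\mathbb{N}$, $\mathcal{U}\leq_{fe}\mathcal{V}$ means that for every $B\in\mathcal{V}$ there is $A\in\mathcal{U}$ with $A\leq_{fe}B$. $\beta\mathbb{N}$ is the space of all ultrafilters on $\mathbb{N}$ with the Stone–Čech topology (basic clopen sets $\{\mathcal{U}\mid A\in\mathcal{U}\}$, $A\subseteq\mathbb{N}$), and $\oplus$ is the extension of addition: $A\in\mathcal{U}\oplus\mathcal{V}$ iff $\{n\in\mathbb{N}\mid \{m\mid n+m\in A\}\in\mathcal{V}\}\in\mathcal{U}$. $K(\beta\mathbb{N},\oplus)$ is the smallest two-sided ideal of the semigroup $(\beta\mathbb{N},\oplus)$, and the bar denotes topological closure in $\beta\mathbb{N}$. *)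

theory Defs
  imports "HOL-Analysis.Analysis"
begin

definition set_fe :: "nat set \<Rightarrow> nat set \<Rightarrow> bool" where
  "set_fe A B \<longleftrightarrow> (\<forall>F. finite F \<and> F \<subseteq> A \<longrightarrow> (\<exists>k. (\<lambda>a. a + k) ` F \<subseteq> B))"

definition is_ultrafilter :: "'a set set \<Rightarrow> bool" where
  "is_ultrafilter U \<longleftrightarrow>
     UNIV \<in> U \<and> {} \<notin> U \<and>
     (\<forall>A B. A \<in> U \<and> B \<in> U \<longrightarrow> A \<inter> B \<in> U) \<and>
     (\<forall>A B. A \<in> U \<and> A \<subseteq> B \<longrightarrow> B \<in> U) \<and>
     (\<forall>A. A \<in> U \<or> - A \<in> U)"

lemma is_ultrafilterD:
  assumes "is_ultrafilter U"
  shows "UNIV \<in> U" "{} \<notin> U"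
    and "A \<in> U \<Longrightarrow> B \<in> U \<Longrightarrow> A \<inter> B \<in> U"
    and "A \<in> U \<Longrightarrow> A \<subseteq> B \<Longrightarrow> B \<in> U"
    and "A \<in> U \<or> - A \<in> U"
  using assms unfolding is_ultrafilter_def by simp_all

lemma is_ultrafilter_Int_iff:
  assumes "is_ultrafilter U"
  shows "A \<inter> B \<in> U \<longleftrightarrow> A \<in> U \<and> B \<in> U"
proof
  assume AB: "A \<inter> B \<in> U"
  show "A \<in> U \<and> B \<in> U"
    using is_ultrafilterD(4)[OF assms AB Int_lower1] is_ultrafilterD(4)[OF assms AB Int_lower2]
    by (rule conjI)
next
  assume "A \<in> U \<and> B \<in> U"
  then show "A \<inter> B \<in> U"
    by (elim conjE) (rule is_ultrafilterD(3)[OF assms])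
qed

lemma is_ultrafilter_Compl_iff:
  assumes "is_ultrafilter U"
  shows "- A \<in> U \<longleftrightarrow> A \<notin> U"
proof -
  have "\<not> (A \<in> U \<and> - A \<in> U)"
    using is_ultrafilterD(2)[OF assms] is_ultrafilter_Int_iff[OF assms, of A "- A"] by simp
  then show ?thesis
    using is_ultrafilterD(5)[OF assms, of A] by argo
qed

typedef beta_nat = "{U :: nat set set. is_ultrafilter U}"
  morphisms members Abs_beta_nat
proof
  show "{A. 0 \<in> A} \<in> {U :: nat set set. is_ultrafilter U}"
    by (auto simp: is_ultrafilter_def)
qed

lemma is_ultrafilter_members: "is_ultrafilter (members U)"
  using members[of U] by simp

definition ultrafilter_fe :: "beta_nat \<Rightarrow> beta_nat \<Rightarrow> bool" where
  "ultrafilter_fe U V \<longleftrightarrow> (\<forall>B \<in> members V. \<exists>A \<in> members U. set_fe A B)"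

definition basic_clopen :: "nat set \<Rightarrow> beta_nat set" where
  "basic_clopen A = {U. A \<in> members U}"

instantiation beta_nat :: topological_space
begin

definition open_beta_nat :: "beta_nat set \<Rightarrow> bool" where
  "open_beta_nat = generate_topology (range basic_clopen)"

instance
  by standard (simp_all add: open_beta_nat_def generate_topology.UNIV generate_topology.Int generate_topology.UN)

end

lemma basic_clopen_UNIV: "basic_clopen UNIV = UNIV"
  by (simp add: basic_clopen_def is_ultrafilterD(1) is_ultrafilter_members)

lemma basic_clopen_Int: "basic_clopen A \<inter> basic_clopen B = basic_clopen (A \<inter> B)"
  by (auto simp: basic_clopen_def is_ultrafilter_Int_iff[OF is_ultrafilter_members])

lemma basic_clopen_Compl: "basic_clopen (- A) = - basic_clopen A"
  by (auto simp: basic_clopen_def is_ultrafilter_Compl_iff[OF is_ultrafilter_members])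

lemma open_basic_clopen: "open (basic_clopen A)"
  by (auto simp: open_beta_nat_def intro: generate_topology.Basis)

lemma closed_basic_clopen: "closed (basic_clopen A)"
  using open_basic_clopen[of "- A"] by (simp add: closed_def basic_clopen_Compl)

lemma topological_basis_basic_clopen: "topological_basis (range basic_clopen)"
proof (rule topological_basisI)
  fix S :: "beta_nat set" and U
  assume "open S" and "U \<in> S"
  have "generate_topology (range basic_clopen) S"
    using \<open>open S\<close> by (simp add: open_beta_nat_def)
  then have "\<forall>U\<in>S. \<exists>A. U \<in> basic_clopen A \<and> basic_clopen A \<subseteq> S"
  proof induction
    case UNIV
    show ?case
      by (intro ballI exI[of _ UNIV]) (simp add: basic_clopen_UNIV)
  next
    case (Int a b)
    show ?case
    proof
      fix U assume "U \<in> a \<inter> b"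
      then obtain A B where "U \<in> basic_clopen A" "basic_clopen A \<subseteq> a"
          "U \<in> basic_clopen B" "basic_clopen B \<subseteq> b"
        using Int.IH by blast
      then have "U \<in> basic_clopen (A \<inter> B) \<and> basic_clopen (A \<inter> B) \<subseteq> a \<inter> b"
        unfolding basic_clopen_Int[symmetric] by blast
      then show "\<exists>C. U \<in> basic_clopen C \<and> basic_clopen C \<subseteq> a \<inter> b" ..
    qed
  next
    case (UN K)
    show ?case
    proof
      fix U assume "U \<in> \<Union>K"
      then obtain k where "k \<in> K" "U \<in> k" ..
      then obtain A where "U \<in> basic_clopen A" "basic_clopen A \<subseteq> k"
        using UN.IH by blast
      then have "U \<in> basic_clopen A \<and> basic_clopen A \<subseteq> \<Union>K"
        using Union_upper[OF \<open>k \<in> K\<close>] by simp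
      then show "\<exists>A. U \<in> basic_clopen A \<and> basic_clopen A \<subseteq> \<Union>K" ..
    qed
  next
    case (Basis s)
    then obtain A where "s = basic_clopen A" ..
    then show ?case by (intro ballI exI[of _ A]) simp
  qed
  then show "\<exists>B'\<in>range basic_clopen. U \<in> B' \<and> B' \<subseteq> S"
    using \<open>U \<in> S\<close> by (simp add: bex_simps)
next
  fix B' :: "beta_nat set"
  assume "B' \<in> range basic_clopen"
  then show "open B'" by (elim rangeE) (simp add: open_basic_clopen)
qed

definition oplus_members :: "nat set set \<Rightarrow> nat set set \<Rightarrow> nat set set" where
  "oplus_members U V = {A. {n. {m. n + m \<in> A} \<in> V} \<in> U}"

lemma is_ultrafilter_oplus_members:
  assumes U: "is_ultrafilter U" and V: "is_ultrafilter V"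
  shows "is_ultrafilter (oplus_members U V)"
proof -
  have Int: "{n. {m. n + m \<in> A \<inter> B} \<in> V}
      = {n. {m. n + m \<in> A} \<in> V} \<inter> {n. {m. n + m \<in> B} \<in> V}" for A B
  proof -
    have "{m. n + m \<in> A \<inter> B} = {m. n + m \<in> A} \<inter> {m. n + m \<in> B}" for n
      by auto
    then show ?thesis by (auto simp: is_ultrafilter_Int_iff[OF V])
  qed
  have Compl: "{n. {m. n + m \<in> - A} \<in> V} = - {n. {m. n + m \<in> A} \<in> V}" for A
  proof -
    have "{m. n + m \<in> - A} = - {m. n + m \<in> A}" for n
      by auto
    then show ?thesis by (auto simp: is_ultrafilter_Compl_iff[OF V])
  qed
  have mono: "{n. {m. n + m \<in> A} \<in> V} \<subseteq> {n. {m. n + m \<in> B} \<in> V}" if "A \<subseteq> B" for A B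
  proof -
    have "A \<inter> B = A" using that by auto
    then show ?thesis using Int[of A B] by auto
  qed
  show ?thesis
    unfolding is_ultrafilter_def oplus_members_def mem_Collect_eq Int Compl
  proof (intro conjI allI impI)
    show "{n. {m. n + m \<in> UNIV} \<in> V} \<in> U" "{n. {m. n + m \<in> {}} \<in> V} \<notin> U"
      using is_ultrafilterD(1,2)[OF U] is_ultrafilterD(1,2)[OF V] by simp_all
  next
    fix A B
    let ?S = "\<lambda>A. {n. {m. n + m \<in> A} \<in> V}"
    show "?S A \<inter> ?S B \<in> U" if "?S A \<in> U \<and> ?S B \<in> U"
      using is_ultrafilterD(3)[OF U conjunct1[OF that] conjunct2[OF that]] .
    show "?S B \<in> U" if "?S A \<in> U \<and> A \<subseteq> B"
      using is_ultrafilterD(4)[OF U conjunct1[OF that] mono[OF conjunct2[OF that]]] .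
    show "?S A \<in> U \<or> - ?S A \<in> U"
      by (rule is_ultrafilterD(5)[OF U])
  qed
qed

instantiation beta_nat :: semigroup_add
begin

definition plus_beta_nat :: "beta_nat \<Rightarrow> beta_nat \<Rightarrow> beta_nat" where
  "U + V = Abs_beta_nat (oplus_members (members U) (members V))"

lemma members_plus: "members (U + V) = oplus_members (members U) (members V)"
  unfolding plus_beta_nat_def
  by (rule Abs_beta_nat_inverse)
    (simp add: is_ultrafilter_oplus_members is_ultrafilter_members)

instance
proof
  fix U V W :: beta_nat
  have "members (U + V + W) = members (U + (V + W))"
    by (simp add: members_plus oplus_members_def add.assoc)
  then show "U + V + W = U + (V + W)"
    by (simp add: members_inject)
qed

end

lemma mem_members_plus:
  "A \<in> members (U + V) \<longleftrightarrow> {n. {m. n + m \<in> A} \<in> members V} \<in> members U"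
  by (simp add: members_plus oplus_members_def)

definition two_sided_ideal :: "'a::semigroup_add set \<Rightarrow> bool" where
  "two_sided_ideal I \<longleftrightarrow> I \<noteq> {} \<and> (\<forall>x\<in>I. \<forall>y. x + y \<in> I \<and> y + x \<in> I)"

(* The least element of the family of two-sided ideals with respect to inclusion.  It need not
   exist in an arbitrary semigroup; it does in a compact right topological one such as beta_nat. *)
definition smallest_ideal :: "'a::semigroup_add set" where
  "smallest_ideal = (LEAST I. two_sided_ideal I)"

lemma smallest_ideal_eqI:
  assumes "two_sided_ideal K" and "\<And>I. two_sided_ideal I \<Longrightarrow> K \<subseteq> I"
  shows "smallest_ideal = K"
  unfolding smallest_ideal_def using assms by (intro Least_equality) auto

end

(* For a fixed ultrafilter V, the set {U. V \<le>_fe U} is a nonempty two-sided ideal (translations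
   commute on the natural numbers) and it is closed, so the intersection of these sets over all V
   contains the closure of the smallest ideal K.  Conversely A \<le>_fe B says that the translates
   B - a with a \<in> A have the finite intersection property, so that some ultrafilter W contains
   all of them, and A \<in> V then yields B \<in> V + W.  Thus if V \<in> K and V \<le>_fe U, every
   member of U is a member of some V + W \<in> K, i.e. U lies in the closure of K. *)
theory Submission
  imports Defs
begin

subsection \<open>The finite intersection property and ultrafilters\<close>

definition fip :: "'a set set \<Rightarrow> bool" where
  "fip S \<longleftrightarrow> (\<forall>X. finite X \<and> X \<subseteq> S \<longrightarrow> \<Inter>X \<noteq> {})"

lemma fip_subset: "fip T \<Longrightarrow> S \<subseteq> T \<Longrightarrow> fip S"
  unfolding fip_def by blast

text \<open>A finite subfamily of the union already lies in one member of the chain. This supplies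
  the upper bounds in both uses of Zorn's lemma.\<close>

lemma fip_Union_chain:
  assumes "subset.chain \<A> \<C>" "\<C> \<noteq> {}" "\<And>S. S \<in> \<C> \<Longrightarrow> fip S"
  shows "fip (\<Union>\<C>)"
  unfolding fip_def
proof (intro allI impI)
  fix X assume X: "finite X \<and> X \<subseteq> \<Union>\<C>"
  then obtain S where "S \<in> \<C>" "X \<subseteq> S"
    using finite_subset_Union_chain[of X \<C> \<A>] assms by metis
  then show "\<Inter>X \<noteq> {}"
    using assms(3) X unfolding fip_def by blast
qed

lemma ultrafilter_Inter:
  assumes "is_ultrafilter U" "finite X" "X \<subseteq> U"
  shows "\<Inter>X \<in> U"
  using assms(2,3) by induction (auto simp: is_ultrafilterD(1,3)[OF assms(1)])

lemma ultrafilter_nonempty: "is_ultrafilter U \<Longrightarrow> A \<in> U \<Longrightarrow> A \<noteq> {}"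
  using is_ultrafilterD(2) by blast

lemma fip_ultrafilter: "is_ultrafilter U \<Longrightarrow> fip U"
  unfolding fip_def using ultrafilter_Inter ultrafilter_nonempty by blast

text \<open>By maximality, a set that can be adjoined without losing \<open>fip\<close> is already
  in M. Hence M contains every superset of a finite intersection of its members, and the ultrafilter
  axioms are instances of this.\<close>

lemma maximal_fip_ultrafilter:
  assumes M: "fip M" and max: "\<And>T. M \<subseteq> T \<Longrightarrow> fip T \<Longrightarrow> T = M"
  shows "is_ultrafilter M"
proof -
  have mem: "A \<in> M" if "finite X" "X \<subseteq> M" "\<Inter>X \<subseteq> A" for A X
  proof -
    have "fip (insert A M)"
      unfolding fip_def
    proof (intro allI impI)
      fix Y assume Y: "finite Y \<and> Y \<subseteq> insert A M"
      \<comment> \<open>A itself need not be in M, so it is replaced by X, whose intersection lies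
        inside A.\<close>
      then have "\<Inter>(X \<union> (Y - {A})) \<noteq> {}"
        using M that unfolding fip_def by (metis Diff_subset_conv Un_least finite_Diff finite_Un insert_is_Un)
      then show "\<Inter>Y \<noteq> {}"
        using that(3) by blast
    qed
    then show ?thesis
      using max[of "insert A M"] by blast
  qed
  have "- A \<in> M" if "A \<notin> M" for A
  proof -
    have "\<not> fip (insert A M)"
      using max[of "insert A M"] that by blast
    then obtain Y where "finite Y" "Y \<subseteq> insert A M" "\<Inter>Y = {}"
      unfolding fip_def by blast
    \<comment> \<open>The sets of Y other than A lie in M, and their intersection misses A.\<close>
    then show ?thesis
      by (intro mem[of "Y - {A}"]) auto
  qed
  moreover have "{} \<notin> M"
    using M unfolding fip_def by (metis Inter_insert empty_subsetI finite.intros Int_empty_left insert_subset)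
  moreover have "UNIV \<in> M"
    by (rule mem[of "{}"]) auto
  moreover have "A \<inter> B \<in> M" if "A \<in> M" "B \<in> M" for A B
    by (rule mem[of "{A, B}"]) (use that in auto)
  moreover have "B \<in> M" if "A \<in> M" "A \<subseteq> B" for A B
    by (rule mem[of "{A}"]) (use that in auto)
  ultimately show ?thesis
    unfolding is_ultrafilter_def by blast
qed

lemma fip_extends_to_ultrafilter:
  assumes "fip S"
  obtains U where "is_ultrafilter U" "S \<subseteq> U"
proof -
  have "\<exists>M\<in>{T. fip T \<and> S \<subseteq> T}. \<forall>T\<in>{T. fip T \<and> S \<subseteq> T}. M \<subseteq> T \<longrightarrow> T = M"
  proof (rule subset_Zorn)
    fix \<C> assume C: "subset.chain {T. fip T \<and> S \<subseteq> T} \<C>"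
    show "\<exists>T\<in>{T. fip T \<and> S \<subseteq> T}. \<forall>X\<in>\<C>. X \<subseteq> T"
    proof (cases "\<C> = {}")
      \<comment> \<open>The union of the empty chain need not contain S, so S itself serves as the
        bound.\<close>
      case True
      then show ?thesis using assms by blast
    next
      case False
      have *: "fip X \<and> S \<subseteq> X" if "X \<in> \<C>" for X
        using C that unfolding subset.chain_def by blast
      then have "fip (\<Union>\<C>)"
        using fip_Union_chain[OF C False] by blast
      then show ?thesis
        using * False by blast
    qed
  qed
  then obtain M where M: "M \<in> {T. fip T \<and> S \<subseteq> T}"
      and max: "\<forall>T\<in>{T. fip T \<and> S \<subseteq> T}. M \<subseteq> T \<longrightarrow> T = M" ..
  have "is_ultrafilter M"
    by (rule maximal_fip_ultrafilter) (use M max in auto)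
  then show thesis
    using that M by simp
qed

section \<open>Points and closures in the space of ultrafilters\<close>

lemma fip_subset_members:
  assumes "fip S"
  obtains U where "S \<subseteq> members U"
  using fip_extends_to_ultrafilter[OF assms] Abs_beta_nat_inverse by (metis mem_Collect_eq)

text \<open>Ultrafilters are maximal: if A were in V but not in U, then \<open>- A\<close> would be
  in U, hence in V.\<close>

lemma beta_nat_eqI:
  assumes "members U \<subseteq> members V"
  shows "U = V"
proof -
  have "members V \<subseteq> members U"
    using assms is_ultrafilter_Compl_iff[OF is_ultrafilter_members] by blast
  then show ?thesis
    using assms members_inject by blast
qed

lemma Compl_members_iff: "- A \<in> members U \<longleftrightarrow> A \<notin> members U"
  by (rule is_ultrafilter_Compl_iff[OF is_ultrafilter_members])

lemma in_closure_beta_nat_iff: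
  "U \<in> closure S \<longleftrightarrow> (\<forall>B\<in>members U. \<exists>V\<in>S. B \<in> members V)"
proof
  assume U: "U \<in> closure S"
  show "\<forall>B\<in>members U. \<exists>V\<in>S. B \<in> members V"
  proof
    fix B assume "B \<in> members U"
    then have "basic_clopen B \<inter> S \<noteq> {}"
      using U open_Int_closure_eq_empty[OF open_basic_clopen, of B S]
      by (auto simp: basic_clopen_def)
    then show "\<exists>V\<in>S. B \<in> members V"
      by (auto simp: basic_clopen_def)
  qed
next
  assume *: "\<forall>B\<in>members U. \<exists>V\<in>S. B \<in> members V"
  show "U \<in> closure S"
  proof (rule ccontr)
    assume "U \<notin> closure S"
    then obtain B where "U \<in> basic_clopen B" "basic_clopen B \<subseteq> - closure S"
      using topological_basisE[OF topological_basis_basic_clopen, of "- closure S" U]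
      by (auto simp: open_Compl)
    then show False
      using * closure_subset[of S] by (auto simp: basic_clopen_def)
  qed
qed

subsection \<open>Existence of the smallest ideal\<close>

text \<open>The hypothesis puts U in the closure of the left ideal
  \<open>range (\<lambda>Z. Z + y)\<close>, so this is the closedness of that ideal. Any W
  containing all sets \<open>?D B\<close> with B in U will do.\<close>

lemma exists_plus_eqI:
  assumes "\<And>B. B \<in> members U \<Longrightarrow> \<exists>Z. B \<in> members (Z + y)"
  shows "\<exists>W. U = W + y"
proof -
  let ?D = "\<lambda>B. {n. {m. n + m \<in> B} \<in> members y}"
  have "fip (?D ` members U)"
    unfolding fip_def
  proof (intro allI impI)
    fix X assume "finite X \<and> X \<subseteq> ?D ` members U"
    then obtain Y where Y: "finite Y" "Y \<subseteq> members U" "X = ?D ` Y"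
      by (meson finite_subset_image)
    then have "\<Inter>Y \<in> members U"
      using ultrafilter_Inter[OF is_ultrafilter_members] by blast
    \<comment> \<open>Using the hypothesis once, for the intersection of Y, yields a single n that
      serves all B in Y.\<close>
    then obtain Z where "?D (\<Inter>Y) \<in> members Z"
      using assms mem_members_plus by blast
    then obtain n where n: "{m. n + m \<in> \<Inter>Y} \<in> members y"
      using ultrafilter_nonempty[OF is_ultrafilter_members] by blast
    have "{m. n + m \<in> B} \<in> members y" if "B \<in> Y" for B
      using is_ultrafilterD(4)[OF is_ultrafilter_members n, of "{m. n + m \<in> B}"] that by blast
    then show "\<Inter>X \<noteq> {}"
      unfolding Y(3) by blast
  qed
  then obtain W where "?D ` members U \<subseteq> members W"
    by (rule fip_subset_members)
  then have "members U \<subseteq> members (W + y)"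
    by (simp add: image_subset_iff subset_iff mem_members_plus)
  then have "U = W + y"
    by (rule beta_nat_eqI)
  then show ?thesis ..
qed

(* A family G stands for the closed set {U. G \<subseteq> members U}; Zorn's lemma for inclusion of
   such families produces a minimal closed left ideal. *)
lemma exists_minimal_left_ideal:
  obtains L :: "beta_nat set" where "L \<noteq> {}" "\<And>X y. y \<in> L \<Longrightarrow> X + y \<in> L"
    "\<And>y. y \<in> L \<Longrightarrow> L \<subseteq> range (\<lambda>X. X + y)"
proof -
  \<comment> \<open>The first conjunct makes the closed set nonempty, the second makes it a left
    ideal. Larger families give smaller closed sets, so a maximal G is wanted.\<close>
  define P where "P G \<longleftrightarrow> fip G \<and> (\<forall>U X. G \<subseteq> members U \<longrightarrow> G \<subseteq> members (X + U))" for G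
  have "\<exists>M\<in>Collect P. \<forall>T\<in>Collect P. M \<subseteq> T \<longrightarrow> T = M"
  proof (rule subset_Zorn)
    fix \<C> assume C: "subset.chain (Collect P) \<C>"
    show "\<exists>T\<in>Collect P. \<forall>X\<in>\<C>. X \<subseteq> T"
    proof (cases "\<C> = {}")
      case True
      have "P {}" by (simp add: P_def fip_def)
      then show ?thesis using True by blast
    next
      case False
      have *: "P G" if "G \<in> \<C>" for G
        using C that unfolding subset.chain_def by blast
      have "fip (\<Union>\<C>)"
        using fip_Union_chain[OF C False] * unfolding P_def by blast
      moreover have "\<Union>\<C> \<subseteq> members (X + U)" if "\<Union>\<C> \<subseteq> members U" for U X
        using * that unfolding P_def by (meson Sup_le_iff)
      ultimately have "P (\<Union>\<C>)"
        unfolding P_def by blast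
      then show ?thesis by blast
    qed
  qed
  then obtain G where G: "P G" and max: "\<And>T. P T \<Longrightarrow> G \<subseteq> T \<Longrightarrow> T = G"
    by blast
  define L where "L = {U. G \<subseteq> members U}"
  have "fip G"
    using G unfolding P_def by blast
  then obtain U0 where "G \<subseteq> members U0"
    by (rule fip_subset_members)
  then have "L \<noteq> {}"
    unfolding L_def by blast
  moreover have left: "X + y \<in> L" if "y \<in> L" for X y
    using G that unfolding P_def L_def by blast
  moreover have "L \<subseteq> range (\<lambda>X. X + y)" if y: "y \<in> L" for y
  proof -
    \<comment> \<open>T encodes the closure of \<open>range (\<lambda>X. X + y)\<close>, which is
      that range itself. Maximality of G will give \<open>T = G\<close>, so that y generates
      L.\<close>
    define T where "T = {B. \<forall>Z. B \<in> members (Z + y)}"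
    have T: "U \<in> range (\<lambda>X. X + y)" if "T \<subseteq> members U" for U
    proof -
      \<comment> \<open>Otherwise \<open>- B\<close> would belong to T and hence to U.\<close>
      have "\<exists>Z. B \<in> members (Z + y)" if "B \<in> members U" for B
        using \<open>T \<subseteq> members U\<close> that Compl_members_iff unfolding T_def by blast
      then show ?thesis
        using exists_plus_eqI by blast
    qed
    have "fip T"
      by (rule fip_subset[OF fip_ultrafilter[OF is_ultrafilter_members[of "y + y"]]])
        (auto simp: T_def)
    moreover have "T \<subseteq> members (X + U)" if U: "T \<subseteq> members U" for U X
    proof -
      obtain W where "U = W + y"
        using T[OF U] by blast
      then have "X + U = (X + W) + y"
        by (simp add: add.assoc)
      then show ?thesis
        unfolding T_def by auto
    qed
    ultimately have "P T"
      unfolding P_def by blast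
    moreover have "G \<subseteq> T"
      using left[OF y] unfolding L_def T_def by blast
    ultimately have "T = G"
      by (rule max)
    then show ?thesis
      using T unfolding L_def by blast
  qed
  ultimately show thesis
    by (rule that)
qed

text \<open>The intersection of all ideals is an ideal once it is nonempty, and a minimal left ideal
  L lies in each of them.\<close>

lemma smallest_ideal_beta_nat:
  "two_sided_ideal (smallest_ideal :: beta_nat set)"
  "two_sided_ideal (I :: beta_nat set) \<Longrightarrow> smallest_ideal \<subseteq> I"
proof -
  define K where "K = \<Inter>{I :: beta_nat set. two_sided_ideal I}"
  obtain L :: "beta_nat set" where L: "L \<noteq> {}" "\<And>X y. y \<in> L \<Longrightarrow> X + y \<in> L"
      "\<And>y. y \<in> L \<Longrightarrow> L \<subseteq> range (\<lambda>X. X + y)"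
    using exists_minimal_left_ideal by blast
  have "L \<subseteq> I" if I: "two_sided_ideal I" for I
  proof -
    obtain i x where "i \<in> I" "x \<in> L"
      using I L(1) unfolding two_sided_ideal_def by blast
    \<comment> \<open>L is generated from the left by each of its elements, so one element in I
      draws all of L into I.\<close>
    then have "i + x \<in> I" "i + x \<in> L"
      using I L(2) unfolding two_sided_ideal_def by blast+
    then show ?thesis
      using L(3)[of "i + x"] I unfolding two_sided_ideal_def by blast
  qed
  then have "K \<noteq> {}"
    using L(1) unfolding K_def by blast
  then have K: "two_sided_ideal K"
    unfolding K_def two_sided_ideal_def by blast
  have least: "K \<subseteq> I" if "two_sided_ideal I" for I
    using that unfolding K_def by blast
  have eq: "smallest_ideal = K"
    using K least by (rule smallest_ideal_eqI)
  show "two_sided_ideal (smallest_ideal :: beta_nat set)"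
    using K unfolding eq .
  show "two_sided_ideal (I :: beta_nat set) \<Longrightarrow> smallest_ideal \<subseteq> I"
    using least unfolding eq by blast
qed

subsection \<open>Finite embeddability\<close>

text \<open>The shifts k that move F into B are exactly the common elements of the translates
  \<open>{m. n + m \<in> B}\<close> with n in F.\<close>

lemma set_fe_iff_ultrafilter:
  "set_fe A B \<longleftrightarrow> (\<exists>W. A \<subseteq> {n. {m. n + m \<in> B} \<in> members W})"
proof
  assume fe: "set_fe A B"
  have "fip ((\<lambda>n. {m. n + m \<in> B}) ` A)"
    unfolding fip_def
  proof (intro allI impI)
    fix X assume "finite X \<and> X \<subseteq> (\<lambda>n. {m. n + m \<in> B}) ` A"
    then obtain F where F: "finite F" "F \<subseteq> A" "X = (\<lambda>n. {m. n + m \<in> B}) ` F"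
      by (meson finite_subset_image)
    then obtain k where "(\<lambda>a. a + k) ` F \<subseteq> B"
      using fe unfolding set_fe_def by blast
    then show "\<Inter>X \<noteq> {}"
      unfolding F(3) by blast
  qed
  then obtain W where "(\<lambda>n. {m. n + m \<in> B}) ` A \<subseteq> members W"
    by (rule fip_subset_members)
  then show "\<exists>W. A \<subseteq> {n. {m. n + m \<in> B} \<in> members W}"
    by blast
next
  assume "\<exists>W. A \<subseteq> {n. {m. n + m \<in> B} \<in> members W}"
  then obtain W where W: "A \<subseteq> {n. {m. n + m \<in> B} \<in> members W}" ..
  show "set_fe A B"
    unfolding set_fe_def
  proof (intro allI impI)
    fix F assume "finite F \<and> F \<subseteq> A"
    then have "\<Inter>((\<lambda>n. {m. n + m \<in> B}) ` F) \<in> members W"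
      using W by (intro ultrafilter_Inter[OF is_ultrafilter_members]) auto
    then show "\<exists>k. (\<lambda>a. a + k) ` F \<subseteq> B"
      using ultrafilter_nonempty[OF is_ultrafilter_members] by blast
  qed
qed

lemma set_fe_trans:
  assumes "set_fe A B" "set_fe B C"
  shows "set_fe A C"
  unfolding set_fe_def
proof (intro allI impI)
  fix F assume F: "finite F \<and> F \<subseteq> A"
  then obtain k where k: "(\<lambda>a. a + k) ` F \<subseteq> B"
    using assms(1) unfolding set_fe_def by blast
  moreover have "finite ((\<lambda>a. a + k) ` F)"
    using F by blast
  ultimately obtain l where "(\<lambda>b. b + l) ` (\<lambda>a. a + k) ` F \<subseteq> C"
    using assms(2) unfolding set_fe_def by blast
  then have "(\<lambda>a. a + (k + l)) ` F \<subseteq> C"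
    by (auto simp: image_subset_iff add.assoc)
  then show "\<exists>k. (\<lambda>a. a + k) ` F \<subseteq> C" ..
qed

lemma set_fe_translate: "set_fe {m. n + m \<in> B} B"
  unfolding set_fe_def by (intro allI impI exI[of _ n]) (auto simp: add.commute)

text \<open>For fixed W, the set \<open>{n. {m. n + m \<in> B} \<in> members W}\<close> is the
  largest A that W embeds in B. So some member of V embeds in B via W iff this set is in V, that is,
  iff B is in \<open>V + W\<close>.\<close>

lemma ultrafilter_fe_iff:
  "ultrafilter_fe V U \<longleftrightarrow> U \<in> closure (range (\<lambda>W. V + W))"
proof -
  have "(\<exists>A\<in>members V. set_fe A B) \<longleftrightarrow> (\<exists>W. B \<in> members (V + W))" for B
    unfolding set_fe_iff_ultrafilter mem_members_plus
    using is_ultrafilterD(4)[OF is_ultrafilter_members] by blast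
  then show ?thesis
    by (simp add: ultrafilter_fe_def in_closure_beta_nat_iff)
qed

text \<open>Each member B of \<open>U + X\<close> or of \<open>X + U\<close> has a member of U
  finitely embeddable in it; transitivity then passes from V through U to B.\<close>

lemma two_sided_ideal_ultrafilter_fe: "two_sided_ideal {U. ultrafilter_fe V U}"
  unfolding two_sided_ideal_def
proof (intro conjI ballI allI)
  have "ultrafilter_fe V (V + V)"
    unfolding ultrafilter_fe_iff by (rule subsetD[OF closure_subset rangeI])
  then show "{U. ultrafilter_fe V U} \<noteq> {}"
    by blast
next
  fix U X assume "U \<in> {U. ultrafilter_fe V U}"
  then have U: "\<exists>A\<in>members V. set_fe A B" if "B \<in> members U" for B
    using that by (simp add: ultrafilter_fe_def)
  have "\<exists>A\<in>members V. set_fe A B" if B: "B \<in> members (U + X)" for B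
  proof -
    \<comment> \<open>The witnessing ultrafilter is X.\<close>
    have "set_fe {n. {m. n + m \<in> B} \<in> members X} B"
      unfolding set_fe_iff_ultrafilter by blast
    then show ?thesis
      using U B unfolding mem_members_plus by (meson set_fe_trans)
  qed
  then show "U + X \<in> {U. ultrafilter_fe V U}"
    by (simp add: ultrafilter_fe_def)
  have "\<exists>A\<in>members V. set_fe A B" if B: "B \<in> members (X + U)" for B
  proof -
    obtain n where "{m. n + m \<in> B} \<in> members U"
      using B ultrafilter_nonempty[OF is_ultrafilter_members] unfolding mem_members_plus by blast
    then show ?thesis
      using U set_fe_translate by (meson set_fe_trans)
  qed
  then show "X + U \<in> {U. ultrafilter_fe V U}"
    by (simp add: ultrafilter_fe_def)
qed

theorem theorem27:
  shows "{U :: beta_nat. \<forall>V :: beta_nat. ultrafilter_fe V U} = closure (smallest_ideal :: beta_nat set)"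
proof (intro equalityI subsetI)
  fix U assume U: "U \<in> {U. \<forall>V. ultrafilter_fe V U}"
  obtain V :: beta_nat where "V \<in> smallest_ideal"
    using smallest_ideal_beta_nat(1) unfolding two_sided_ideal_def by blast
  then have "range (\<lambda>W. V + W) \<subseteq> smallest_ideal"
    using smallest_ideal_beta_nat(1) unfolding two_sided_ideal_def by blast
  moreover have "U \<in> closure (range (\<lambda>W. V + W))"
    using U by (simp add: ultrafilter_fe_iff)
  ultimately show "U \<in> closure smallest_ideal"
    using closure_mono by blast
next
  fix U :: beta_nat assume U: "U \<in> closure smallest_ideal"
  have "ultrafilter_fe V U" for V
  proof -
    \<comment> \<open>This closure is the ideal \<open>{U. ultrafilter_fe V U}\<close>; being
      closed, it also contains the closure of the smallest ideal.\<close>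
    have "smallest_ideal \<subseteq> closure (range (\<lambda>W. V + W))"
      using smallest_ideal_beta_nat(2)[OF two_sided_ideal_ultrafilter_fe, of V]
      by (auto simp: ultrafilter_fe_iff)
    then have "closure smallest_ideal \<subseteq> closure (range (\<lambda>W. V + W))"
      by (rule closure_minimal) simp
    then show ?thesis
      using U by (auto simp: ultrafilter_fe_iff)
  qed
  then show "U \<in> {U. \<forall>V. ultrafilter_fe V U}"
    by blast
qed

end
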